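(* Let $n\ge 1$, let $p_1,\dots,p_n$ be positive integers and $M=\{1^{p_1},2^{p_2},\dots,n^{p_n}\}$. The map $T\mapsto \widehat{T}$ (defined in the context) is a bijection from $\mathcal{T}_M$ to $\mathcal{T}_M$, and for every $T\in\mathcal{T}_M$ and every integer $q\ge 0$, $$\mathsf{deg}_q(T)=\begin{cases}\mathsf{od}_{q-1}(\widehat{T}) & \text{if } q\ge 1,\\ \mathsf{el}(\widehat{T}) & \text{if } q=0.\end{cases}$$
   Context: A plane tree is a rooted tree in which the children of every node are linearly ordered (drawn left to right). For the multiset $M=\{1^{p_1},\dots,n^{p_n}\}$ with $p=p_1+\cdots+p_n$, a weakly increasing tree on $M$ is a plane tree with $p+1$ nodes labeled by the elements of the multiset $M\cup\{0\}$ (each label used exactly with its multiplicity) such that the labels weakly increase along every path from the root to a leaf, and for every node the labels of its children weakly increase from left to right (so the root is labeled $0$). $\mathcal{T}_M$ denotes the set of weakly increasing trees on $M$. The degree of a node is its number of children; the level of a node is the number of edges on the path from the root to it (the root has level $0$). For a tree $T$: $\mathsf{deg}_q(T)$ is the number of nodes of degree $q$; $\mathsf{od}_q(T)$ is the number of nodes of degree $q$ lying on odd levels; $\mathsf{el}(T)$ is the number of nodes lying on even levels. The map $T\mapsto\widehat T$ is defined recursively on labeled plane trees whose labels weakly increase along root-to-leaf paths and among siblings from left to right: if $T$ is a single node, $\widehat T=T$. Otherwise let $r$ be the label of the root, let $v$ be the leftmost child of the root and $c$ its label, let $H$ be the subtree consisting of $v$ and all its descendants, and let $u_1,\dots,u_s$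 be the other children of the root from left to right, with $T_{u_i}$ the subtree consisting of $u_i$ and its descendants. Then $\widehat T$ is obtained by taking $\widehat H$ (whose root is labeled $c$), changing the label of its root to $r$, attaching a new node labeled $c$ as the leftmost child of this root, and attaching $\widehat{T_{u_1}},\dots,\widehat{T_{u_s}}$ as the subtrees of this new node $c$, from left to right (these being all the children of the new node). *)

theory Defs
  imports Main "HOL-Library.Multiset"
begin

text \<open>A node carries a label and the left-to-right list of the subtrees rooted at its children.\<close>

datatype 'a ptree = Node (label: 'a) (children: "'a ptree list")

lemma size_nth_child [termination_simp]:
  "i < length ts \<Longrightarrow> size (ts ! i) < Suc (size_list size ts)"
  by (rule le_imp_less_Suc, rule size_list_estimation'[of "ts ! i"]) auto

text \<open>
  Nodes are identified by their addresses, i.e. the list of child indices on the path from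
  the root. The level of a node is the length of its address.
\<close>

fun nodes :: "'a ptree \<Rightarrow> nat list set" where
  "nodes (Node a ts) = insert [] (\<Union>i<length ts. (#) i ` nodes (ts ! i))"

fun subtree_at :: "'a ptree \<Rightarrow> nat list \<Rightarrow> 'a ptree" where
  "subtree_at t [] = t"
| "subtree_at t (i # v) = subtree_at (children t ! i) v"

definition degree :: "'a ptree \<Rightarrow> nat list \<Rightarrow> nat" where
  "degree t v = length (children (subtree_at t v))"

abbreviation level :: "nat list \<Rightarrow> nat" where
  "level v \<equiv> length v"

fun labels :: "'a ptree \<Rightarrow> 'a multiset" where
  "labels (Node a ts) = add_mset a (\<Sum>t\<leftarrow>ts. labels t)"

text \<open>The label sequences read along the paths from the root to the leaves.\<close>

fun path_labels :: "'a ptree \<Rightarrow> 'a list set" where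
  "path_labels (Node a ts) = (if ts = [] then {[a]} else (#) a ` (\<Union>t\<in>set ts. path_labels t))"

definition weakly_increasing :: "'a::linorder ptree \<Rightarrow> bool" where
  "weakly_increasing t \<longleftrightarrow>
     (\<forall>xs\<in>path_labels t. sorted xs) \<and>
     (\<forall>v\<in>nodes t. sorted (map label (children (subtree_at t v))))"

definition wi_trees :: "nat multiset \<Rightarrow> nat ptree set" where
  "wi_trees M = {t. labels t = add_mset 0 M \<and> weakly_increasing t}"

definition deg_count :: "nat \<Rightarrow> 'a ptree \<Rightarrow> nat" where
  "deg_count q t = card {v \<in> nodes t. degree t v = q}"

definition odd_deg_count :: "nat \<Rightarrow> 'a ptree \<Rightarrow> nat" where
  "odd_deg_count q t = card {v \<in> nodes t. odd (level v) \<and> degree t v = q}"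

definition even_level_count :: "'a ptree \<Rightarrow> nat" where
  "even_level_count t = card {v \<in> nodes t. even (level v)}"

text \<open>
  In the second equation \<open>h\<close> is the subtree at the leftmost child of the root; the root
  of \<open>hat h\<close> is relabelled by \<open>r\<close> and receives a new leftmost child labelled as the root
  of \<open>h\<close>. The function is total, while only its values on weakly increasing trees matter.
\<close>

fun hat :: "'a ptree \<Rightarrow> 'a ptree" where
  "hat (Node r []) = Node r []"
| "hat (Node r (h # us)) = Node r (Node (label h) (map hat us) # children (hat h))"

end

theory Submission
  imports Defs
begin

text \<open>
  The root of \<open>hat t\<close> keeps its label, so the leftmost child of the root in \<open>hat t\<close>, together
  with the remaining root subtrees, determines the two pieces \<open>map hat us\<close> and \<open>hat h\<close> from which
  \<open>hat t\<close> was assembled; hence \<open>hat\<close> is invertible on all labelled plane trees. It preserves the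
  labels, and \<open>hat t\<close> is weakly increasing iff \<open>t\<close> is. For the statistics, the root of \<open>t\<close>, of
  degree \<open>q + 1\<close>, corresponds to the new node of degree \<open>q\<close> on level 1 of \<open>hat t\<close>, while the parity
  of the levels inherited from \<open>hat h\<close> and from the \<open>hat u\<close> is unchanged, the latter being shifted
  by 2.
\<close>

lemma label_hat [simp]: "label (hat t) = label t"
  by (cases t rule: hat.cases) simp_all

text \<open>On an argument \<open>hat (Node r (h # us))\<close>, \<open>c\<close> is the root label
  that \<open>hat h\<close> had before relabelling, so \<open>Node c ws\<close> is
  \<open>hat h\<close> itself.\<close>

fun unhat :: "'a ptree \<Rightarrow> 'a ptree" where
  "unhat (Node r []) = Node r []"
| "unhat (Node r (Node c us # ws)) = Node r (unhat (Node c ws) # map unhat us)"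

lemma label_unhat [simp]: "label (unhat t) = label t"
  by (cases t rule: unhat.cases) simp_all

lemma unhat_hat [simp]: "unhat (hat t) = t"
proof (induction t rule: hat.induct)
  case (2 r h us)
  have "Node (label h) (children (hat h)) = hat h"
    by (metis label_hat ptree.collapse)
  with 2 show ?case
    by (simp add: map_idI)
qed simp

lemma hat_unhat [simp]: "hat (unhat t) = t"
  by (induction t rule: unhat.induct) (simp_all add: map_idI)

lemma labels_hat [simp]: "labels (hat t) = labels t"
proof (induction t rule: hat.induct)
  case (2 r h us)
  have "labels (hat h) = add_mset (label h) (\<Sum>t\<leftarrow>children (hat h). labels t)"
    by (metis label_hat labels.simps ptree.collapse)
  moreover have "sum_list (map (labels \<circ> hat) us) =
      sum_list (map labels us)"
    using 2 by (simp cong: map_cong)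
  ultimately show ?case
    using 2 by simp
qed simp

lemma path_labels_nonempty: "path_labels t \<noteq> {}"
  by (induction t) auto

lemma path_labels_eq_Cons: "xs \<in> path_labels t \<Longrightarrow> \<exists>ys. xs = label t # ys"
  by (cases t) (auto split: if_splits)

lemma sorted_path_labels_Node:
  fixes a :: "'a::linorder"
  shows "(\<forall>xs\<in>path_labels (Node a ts). sorted xs) \<longleftrightarrow>
    (\<forall>t\<in>set ts. a \<le> label t \<and> (\<forall>xs\<in>path_labels t. sorted xs))"
proof -
  have "(\<forall>xs\<in>path_labels t. sorted (a # xs)) \<longleftrightarrow>
      a \<le> label t \<and> (\<forall>xs\<in>path_labels t. sorted xs)" for t
  proof -
    have "sorted (a # xs) \<longleftrightarrow> a \<le> label t \<and> sorted xs" if "xs \<in> path_labels t" for xs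
      using path_labels_eq_Cons[OF that] by force
    \<comment> \<open>The bound \<open>a \<le> label t\<close> mentions no path, so some path of
      \<open>t\<close> must exist to yield it.\<close>
    then show ?thesis
      using path_labels_nonempty[of t] by blast
  qed
  then show ?thesis
    by (cases "ts = []") (simp, auto simp del: sorted_wrt.simps)
qed

lemma weakly_increasing_Node:
  "weakly_increasing (Node a ts) \<longleftrightarrow>
     sorted (map label ts) \<and> (\<forall>t\<in>set ts. a \<le> label t \<and> weakly_increasing t)"
  unfolding weakly_increasing_def sorted_path_labels_Node
  by (auto simp: all_set_conv_all_nth)

text \<open>For \<open>c = label h\<close>, the bounds of \<open>c\<close> by the labels of
  \<open>us\<close> turn from sibling into parent-child conditions; those by the children of
  \<open>hat h\<close> turn the other way.\<close>

lemma weakly_increasing_hat: "weakly_increasing (hat t) \<longleftrightarrow> weakly_increasing t"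
proof (induction t rule: hat.induct)
  case (2 r h us)
  have "weakly_increasing (hat h) \<longleftrightarrow> sorted (map label (children (hat h))) \<and>
      (\<forall>t\<in>set (children (hat h)). label h \<le> label t \<and> weakly_increasing t)"
    by (metis label_hat ptree.collapse weakly_increasing_Node)
  with 2 show ?case
    by (auto simp: weakly_increasing_Node comp_def)
qed simp

lemma bij_betw_hat: "bij_betw hat (wi_trees M) (wi_trees M)"
proof (rule bij_betw_byWitness[where f' = unhat])
  show "unhat ` wi_trees M \<subseteq> wi_trees M"
    \<comment> \<open>Read from right to left, both facts lead to \<open>hat (unhat t)\<close>,
      which is \<open>t\<close>.\<close>
    by (auto simp: wi_trees_def weakly_increasing_hat[of "unhat _", symmetric]
        labels_hat[of "unhat _", symmetric] simp del: labels_hat)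
qed (auto simp: wi_trees_def weakly_increasing_hat)

lemma finite_nodes [simp]: "finite (nodes t)"
  by (induction t) simp

text \<open>\<open>P\<close> sees the level so that descending to a child merely shifts it; all
  three statistics are instances.\<close>

definition node_count :: "(nat \<Rightarrow> nat \<Rightarrow> bool) \<Rightarrow> 'a ptree \<Rightarrow> nat" where
  "node_count P t = card {v \<in> nodes t. P (level v) (degree t v)}"

lemma node_count_Node:
  "node_count P (Node a ts) =
     of_bool (P 0 (length ts)) + (\<Sum>t\<leftarrow>ts. node_count (\<lambda>l. P (Suc l)) t)"
proof -
  define A where "A i = {v \<in> nodes (ts ! i). P (Suc (level v)) (degree (ts ! i) v)}" for i
  define R where "R = (if P 0 (length ts) then {[] :: nat list} else {})"
  have "{v \<in> nodes (Node a ts). P (level v) (degree (Node a ts) v)} =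
      R \<union> (\<Union>i<length ts. (#) i ` A i)"
    by (auto simp: A_def R_def degree_def)
  moreover have "card (R \<union> (\<Union>i<length ts. (#) i ` A i)) =
      card R + card (\<Union>i<length ts. (#) i ` A i)"
    by (rule card_Un_disjoint) (auto simp: A_def R_def)
  moreover have "card (\<Union>i<length ts. (#) i ` A i) = (\<Sum>i<length ts. card ((#) i ` A i))"
    by (rule card_UN_disjoint) (auto simp: A_def)
  moreover have "card ((#) i ` A i) = node_count (\<lambda>l. P (Suc l)) (ts ! i)" for i
    by (simp add: A_def node_count_def card_image)
  moreover have "card R = of_bool (P 0 (length ts))"
    by (simp add: R_def)
  ultimately show ?thesis
    by (simp add: node_count_def sum_list_sum_nth atLeast0LessThan)
qed

lemma node_count_children:
  "node_count P t = of_bool (P 0 (length (children t))) +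
     (\<Sum>u\<leftarrow>children t. node_count (\<lambda>l. P (Suc l)) u)"
  by (metis node_count_Node ptree.collapse)

text \<open>The roots of \<open>hat h\<close> and \<open>hat (Node r (h # us))\<close> differ in
  degree, but level 0 is not counted on the left.\<close>

lemma node_count_odd_hat:
  "node_count (\<lambda>l d. odd l \<and> d = q) (hat t) = node_count (\<lambda>l d. d = Suc q) t"
proof (induction t rule: hat.induct)
  case (2 r h us)
  have "sum_list (map (node_count (\<lambda>l d. odd l \<and> d = q) \<circ> hat) us) =
      sum_list (map (node_count (\<lambda>l d. d = Suc q)) us)"
    using 2 by (simp cong: map_cong)
  then show ?case
    using 2 node_count_children[of "\<lambda>l d. odd l \<and> d = q" "hat h"]
    by (simp add: node_count_Node)
qed (simp add: node_count_Node)

text \<open>The new node has odd level and the root of \<open>Node r (h # us)\<close> is no leaf, so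
  neither is counted; the root of \<open>hat h\<close> counts once before and after
  relabelling.\<close>

lemma node_count_even_hat:
  "node_count (\<lambda>l d. even l) (hat t) = node_count (\<lambda>l d. d = 0) t"
proof (induction t rule: hat.induct)
  case (2 r h us)
  have "sum_list (map (node_count (\<lambda>l d. even l) \<circ> hat) us) =
      sum_list (map (node_count (\<lambda>l d. d = 0)) us)"
    using 2 by (simp cong: map_cong)
  then show ?case
    using 2 node_count_children[of "\<lambda>l d. even l" "hat h"]
    by (simp add: node_count_Node)
qed (simp add: node_count_Node)

theorem theorem1p2:
  fixes n :: nat and p :: "nat \<Rightarrow> nat" and M :: "nat multiset"
  assumes "n \<ge> 1"
    and "\<And>i. i \<in> {1..n} \<Longrightarrow> p i > 0"
    and "M = (\<Sum>i\<in>{1..n}. replicate_mset (p i) i)"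
  shows "bij_betw hat (wi_trees M) (wi_trees M) \<and>
    (\<forall>T\<in>wi_trees M. \<forall>q::nat.
       deg_count q T = (if q \<ge> 1 then odd_deg_count (q - 1) (hat T) else even_level_count (hat T)))"
proof (intro conjI ballI allI)
  show "bij_betw hat (wi_trees M) (wi_trees M)"
    by (rule bij_betw_hat)
  fix T :: "nat ptree" and q :: nat
  show "deg_count q T =
      (if q \<ge> 1 then odd_deg_count (q - 1) (hat T) else even_level_count (hat T))"
    using node_count_odd_hat[of "q - 1" T] node_count_even_hat[of T]
    by (cases q)
      (simp_all add: node_count_def deg_count_def odd_deg_count_def even_level_count_def)
qed

end
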